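(* For every singular cardinal $\lambda$ of countable cofinality there is a $(\lambda,\lambda^+)$-graph of type $T_\lambda$ that does not have an $(\aleph_0,\lambda^+)$-subgraph.
   Context: For infinite cardinals $\lambda<\kappa$, a $(\lambda,\kappa)$-graph is a bipartite graph with bipartition $(A,B)$, $|A|=\lambda$, $|B|=\kappa$, in which every $b\in B$ has infinitely many neighbours in $A$. An $(\lambda',\kappa)$-subgraph of it is a subgraph with bipartition $(C,D)$, $C\subseteq A$, $D\subseteq B$, that is itself a $(\lambda',\kappa)$-graph. For a cardinal $\lambda$, $T_\lambda$ is the order tree of all sequences of elements of $\lambda$ of length at most $\omega$ (including the empty sequence), ordered by initial segment; $T_\lambda^{<\omega}$ consists of the finite sequences and $T_\lambda^\omega$ of the $\omega$-sequences. For $\kappa>\lambda$, the down-closure $T$ of a $\kappa$-sized set $X\subseteq T_\lambda^\omega$ is a $\lambda$-tree with $\kappa$ tops (the tops being the elements of $X$). A $T$-graph is a graph with vertex set $T$ in which the endvertices of every edge are comparable and for every $t$ the neighbours of $t$ below $t$ are cofinal in $\{s : s<t\}$. A $(\lambda,\kappa)$-graph of type $T_\lambda$ is the bipartite graph with bipartition classes $T^{<\omega}$ and $X$ formed by the edges between these sets of some $T$-graph, where $T$ is a $\lambda$-tree with $\kappa$ tops $X$. *)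

theory Defs
  imports Main "HOL-Library.Countable_Set"
begin

unbundle cardinal_syntax

text \<open>Vertices of the tree T_lambda: finite sequences (Inl) and omega-sequences (Inr)
  of elements of a set L (playing the role of the cardinal lambda).\<close>
type_synonym 'a tnode = "'a list + (nat \<Rightarrow> 'a)"

definition in_T :: "'a set \<Rightarrow> 'a tnode \<Rightarrow> bool" where
  "in_T L t = (case t of Inl xs \<Rightarrow> set xs \<subseteq> L | Inr f \<Rightarrow> range f \<subseteq> L)"

definition tless :: "'a tnode \<Rightarrow> 'a tnode \<Rightarrow> bool" where
  "tless s t = (case (s, t) of
      (Inl xs, Inl ys) \<Rightarrow> length xs < length ys \<and> xs = take (length xs) ys
    | (Inl xs, Inr f) \<Rightarrow> xs = map f [0..<length xs]
    | (Inr _, _) \<Rightarrow> False)"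

definition comparable :: "'a tnode \<Rightarrow> 'a tnode \<Rightarrow> bool" where
  "comparable s t = (s = t \<or> tless s t \<or> tless t s)"

definition down_closure :: "(nat \<Rightarrow> 'a) set \<Rightarrow> 'a tnode set" where
  "down_closure X = Inr ` X \<union> {Inl (map f [0..<n]) | f n. f \<in> X}"

definition tree_with_tops :: "'a set \<Rightarrow> 'b rel \<Rightarrow> (nat \<Rightarrow> 'a) set \<Rightarrow> 'a tnode set \<Rightarrow> bool" where
  "tree_with_tops L kap X T =
     ((\<forall>f\<in>X. range f \<subseteq> L) \<and> |X| =o kap \<and> T = down_closure X)"

definition T_graph :: "'a tnode set \<Rightarrow> ('a tnode \<times> 'a tnode) set \<Rightarrow> bool" where
  "T_graph T E =
     (E \<subseteq> T \<times> T \<and> sym E \<and> (\<forall>(s,t)\<in>E. s \<noteq> t \<and> comparable s t) \<and>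
      (\<forall>t\<in>T. \<forall>s\<in>T. tless s t \<longrightarrow>
           (\<exists>u\<in>T. (s = u \<or> tless s u) \<and> tless u t \<and> (u,t) \<in> E)))"

definition lk_graph :: "'c rel \<Rightarrow> 'd rel \<Rightarrow> 'v set \<Rightarrow> 'w set \<Rightarrow> ('v \<times> 'w) set \<Rightarrow> bool" where
  "lk_graph lam kap A B E =
     (E \<subseteq> A \<times> B \<and> |A| =o lam \<and> |B| =o kap \<and>
      (\<forall>b\<in>B. infinite {a\<in>A. (a,b) \<in> E}))"

definition has_subgraph :: "'c rel \<Rightarrow> 'd rel \<Rightarrow> 'v set \<Rightarrow> 'w set \<Rightarrow> ('v \<times> 'w) set \<Rightarrow> bool" where
  "has_subgraph lam' kap A B E =
     (\<exists>C D F. C \<subseteq> A \<and> D \<subseteq> B \<and> F \<subseteq> E \<and> lk_graph lam' kap C D F)"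

definition type_T_graph :: "'a set \<Rightarrow> 'b rel \<Rightarrow> 'a list set \<Rightarrow> (nat \<Rightarrow> 'a) set \<Rightarrow> ('a list \<times> (nat \<Rightarrow> 'a)) set \<Rightarrow> bool" where
  "type_T_graph L kap A B H =
     (\<exists>X T E. tree_with_tops L kap X T \<and> T_graph T E \<and>
        A = {xs. Inl xs \<in> T} \<and> B = X \<and>
        H = {(xs, f). (Inl xs, Inr f) \<in> E})"

end

theory Submission
  imports Defs
begin

text \<open>Taking all comparable pairs as edges, it suffices to find \<open>\<lambda>\<^sup>+\<close> functions \<open>\<omega> \<rightarrow> \<lambda>\<close> such that every countable
  subset of \<open>\<lambda>\<close> contains the ranges of at most \<open>\<lambda>\<close> of them. Write \<open>\<lambda>\<close> as an increasing union of sets \<open>A\<^sub>n\<close> of smaller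
  size. For \<open>d < \<lambda>\<^sup>+\<close> cover the predecessors of \<open>d\<close> by an increasing sequence of topologically closed sets \<open>B d n\<close> of size
  at most \<open>|A\<^sub>n|\<close>, and choose \<open>f d n < |A\<^sub>n|\<^sup>+\<close> recursively above all \<open>f x n\<close> with \<open>x \<in> B d n\<close>. Club guessing on
  \<open>\<omega>\<^sub>3\<close> shows that every unbounded subset of \<open>\<lambda>\<^sup>+\<close> has an uncountable subset on which some coordinate of \<open>f\<close> is strictly
  increasing; hence \<open>\<lambda>\<^sup>+\<close> many of the \<open>f d\<close> never take their values in one countable set.\<close>

section \<open>Successor cardinals as well-ordered types\<close>

text \<open>The successor cardinal of \<open>'a\<close> is made a type so that it lives in class \<open>wellorder\<close>; iterating from
  \<open>nat\<close> gives \<open>\<omega>\<^sub>1\<close>, \<open>\<omega>\<^sub>2\<close> and \<open>\<omega>\<^sub>3\<close>.\<close>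
typedef 'a csuc = "Field (cardSuc (card_of (UNIV :: 'a set)))"
proof -
  have "\<not> cardSuc (card_of (UNIV :: 'a set)) \<le>o card_of (UNIV :: 'a set)"
    using cardSuc_greater[OF card_of_Card_order] not_ordLess_ordLeq by blast
  moreover have "card_of (Field (cardSuc (card_of (UNIV :: 'a set)))) =o cardSuc (card_of (UNIV :: 'a set))"
    by (intro card_of_Field_ordIso cardSuc_Card_order card_of_Card_order)
  ultimately have "Field (cardSuc (card_of (UNIV :: 'a set))) \<noteq> {}"
    by (metis card_of_empty ordIso_iff_ordLeq ordLeq_transitive)
  then show ?thesis by blast
qed

lemma well_order_on_cardSuc: "well_order_on (Field (cardSuc (card_of A))) (cardSuc (card_of A))"
  by (intro cardSuc_Well_order card_of_Card_order)

instantiation csuc :: (type) wellorder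
begin

definition less_eq_csuc :: "'a csuc \<Rightarrow> 'a csuc \<Rightarrow> bool" where
  "x \<le> y \<longleftrightarrow> (Rep_csuc x, Rep_csuc y) \<in> cardSuc (card_of (UNIV :: 'a set))"

definition less_csuc :: "'a csuc \<Rightarrow> 'a csuc \<Rightarrow> bool" where
  "x < y \<longleftrightarrow> x \<le> y \<and> x \<noteq> (y :: 'a csuc)"

instance
proof
  note wo = well_order_on_cardSuc[of "UNIV :: 'a set",
      unfolded well_order_on_def linear_order_on_def partial_order_on_def preorder_on_def]
  fix x y z :: "'a csuc"
  show "x \<le> x"
    using wo Rep_csuc[of x] by (auto simp: less_eq_csuc_def refl_on_def)
  show antisym: "x \<le> y \<Longrightarrow> y \<le> x \<Longrightarrow> x = y"
    using wo unfolding less_eq_csuc_def antisym_def by (metis Rep_csuc_inject)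
  show "x < y \<longleftrightarrow> x \<le> y \<and> \<not> y \<le> x"
    using wo \<open>x \<le> x\<close> unfolding less_csuc_def less_eq_csuc_def antisym_def by (metis Rep_csuc_inject)
  show "x \<le> y \<Longrightarrow> y \<le> z \<Longrightarrow> x \<le> z"
    using wo unfolding less_eq_csuc_def trans_def by blast
  show "x \<le> y \<or> y \<le> x"
    using wo Rep_csuc[of x] Rep_csuc[of y] unfolding less_eq_csuc_def total_on_def refl_on_def
    by metis
  have wf: "wf (inv_image (cardSuc (card_of (UNIV :: 'a set)) - Id) Rep_csuc)"
    using wo by simp
  fix P :: "'a csuc \<Rightarrow> bool" and a
  assume step: "\<And>x. (\<And>y. y < x \<Longrightarrow> P y) \<Longrightarrow> P x"
  show "P a"
    using wf
  proof (induction a rule: wf_induct_rule)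
    case (less x)
    show ?case
      by (rule step, rule less) (auto simp: less_csuc_def less_eq_csuc_def inv_image_def Rep_csuc_inject)
  qed
qed

end

lemma card_of_UNIV_csuc: "card_of (UNIV :: 'a csuc set) =o cardSuc (card_of (UNIV :: 'a set))"
proof -
  have "bij_betw Rep_csuc (UNIV :: 'a csuc set) (Field (cardSuc (card_of (UNIV :: 'a set))))"
    by (metis Rep_csuc_inject bij_betw_def inj_onI type_definition.Rep_range type_definition_csuc)
  then have "card_of (UNIV :: 'a csuc set) =o card_of (Field (cardSuc (card_of (UNIV :: 'a set))))"
    using card_of_ordIso by blast
  then show ?thesis
    by (metis card_of_Card_order cardSuc_Card_order card_of_Field_ordIso ordIso_transitive)
qed

lemma card_of_UNIV_less_csuc: "card_of (UNIV :: 'a set) <o card_of (UNIV :: 'a csuc set)"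
  by (rule ordLess_ordIso_trans[OF cardSuc_greater[OF card_of_Card_order] ordIso_symmetric[OF card_of_UNIV_csuc]])

lemma infinite_UNIV_csuc: "infinite (UNIV :: 'a set) \<Longrightarrow> infinite (UNIV :: 'a csuc set)"
  using card_of_ordLeq_finite[OF ordLess_imp_ordLeq[OF card_of_UNIV_less_csuc]] by blast

lemma card_of_lessThan_csuc: "card_of {..<x :: 'a csuc} \<le>o card_of (UNIV :: 'a set)"
proof -
  let ?r = "cardSuc (card_of (UNIV :: 'a set))"
  have "card_of {..<x} =o card_of (Rep_csuc ` {..<x})"
    by (meson Rep_csuc_inject bij_betw_imageI card_of_ordIsoI inj_onI)
  also have "card_of (Rep_csuc ` {..<x}) \<le>o card_of (underS ?r (Rep_csuc x))"
    by (rule card_of_mono1) (auto simp: underS_def less_csuc_def less_eq_csuc_def Rep_csuc_inject)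
  also have "card_of (underS ?r (Rep_csuc x)) <o ?r"
    by (rule card_of_underS) (simp_all only: cardSuc_Card_order card_of_Card_order Rep_csuc)
  finally show ?thesis
    by (metis card_of_Card_order cardSuc_ordLeq_ordLess)
qed

lemma card_of_insert_infinite:
  "infinite B \<Longrightarrow> card_of A \<le>o card_of B \<Longrightarrow> card_of (insert x A) \<le>o card_of B"
proof -
  assume "infinite B" and "card_of A \<le>o card_of B"
  moreover have "card_of {x} \<le>o card_of B"
    using \<open>infinite B\<close> by (metis card_of_singl_ordLeq finite.emptyI)
  ultimately have "card_of ({x} \<union> A) \<le>o card_of B"
    by (intro card_of_Un_ordLeq_infinite_Field card_of_Card_order) (auto simp: Field_card_of)
  then show ?thesis by simp
qed

text \<open>A copy of the successor cardinal of \<open>A\<close> as an initial segment of \<open>'a csuc\<close>.\<close>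
definition below :: "'a set \<Rightarrow> 'a csuc set" where
  "below A = {x. card_of {..<x} \<le>o card_of A}"

lemma below_UNIV: "below (UNIV :: 'a set) = UNIV"
  by (simp add: below_def card_of_lessThan_csuc)

lemma below_downward: "x \<in> below A \<Longrightarrow> y \<le> x \<Longrightarrow> y \<in> below A"
  unfolding below_def using ordLeq_transitive[OF card_of_mono1[of "{..<y}" "{..<x}"]] by auto

lemma card_of_atMost_below:
  "infinite A \<Longrightarrow> x \<in> below A \<Longrightarrow> card_of {..x} \<le>o card_of A"
proof -
  assume "infinite A" "x \<in> below A"
  moreover have "{..x} = insert x {..<x}"
    by auto
  ultimately show ?thesis
    by (simp add: below_def card_of_insert_infinite)
qed

text \<open>The segments \<open>{..z}\<close> have size at most \<open>|A|\<close>, so their union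
  does too and misses a point. The least missed point has its whole segment inside the union, hence
  lies in \<open>below A\<close>. This is the regularity of a successor cardinal.\<close>

lemma below_bounded:
  assumes "infinite A" "Z \<subseteq> below A" "card_of Z \<le>o card_of A"
  shows "\<exists>b\<in>below A. \<forall>z\<in>Z. z < b"
proof -
  define U where "U = (\<Union>z\<in>Z. {..z})"
  have U: "card_of U \<le>o card_of A"
    unfolding U_def using assms card_of_atMost_below[OF assms(1)]
    by (intro card_of_UNION_ordLeq_infinite) auto
  have "U \<noteq> UNIV"
  proof
    assume "U = UNIV"
    then have "card_of (UNIV :: 'a csuc set) \<le>o card_of (UNIV :: 'a set)"
      using U card_of_mono1[OF subset_UNIV, of A] ordLeq_transitive by metis
    then show False
      using card_of_UNIV_less_csuc not_ordLess_ordLeq by blast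
  qed
  define b where "b = (LEAST b. b \<notin> U)"
  have "b \<notin> U"
    using \<open>U \<noteq> UNIV\<close> unfolding b_def by (metis LeastI UNIV_eq_I)
  then have "\<forall>z\<in>Z. z < b"
    by (auto simp: U_def not_le)
  moreover have "{..<b} \<subseteq> U"
    unfolding b_def using not_less_Least by auto
  then have "b \<in> below A"
    using U card_of_mono1 ordLeq_transitive unfolding below_def by blast
  ultimately show ?thesis by blast
qed

lemma csuc_bounded:
  fixes Z :: "'a csuc set"
  assumes "infinite (UNIV :: 'a set)" "card_of Z \<le>o card_of (UNIV :: 'a set)"
  shows "\<exists>b. \<forall>z\<in>Z. z < b"
  using below_bounded[of "UNIV :: 'a set" Z] assms by (auto simp: below_UNIV)

text \<open>By \<open>below_bounded\<close> the set is too large for \<open>|A|\<close>. For the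
  upper bound, a subset of size \<open>|A|\<close> successor cannot lie in one segment, so it is
  cofinal and \<open>below A\<close> is a union of that many segments, each of size at most
  \<open>|A|\<close>.\<close>

lemma card_of_below:
  assumes "infinite A"
  shows "card_of (below A) =o cardSuc (card_of A)"
proof -
  let ?k = "cardSuc (card_of A)"
  have "\<not> card_of (below A) \<le>o card_of A"
    using below_bounded[OF assms subset_refl] by blast
  then have ge: "?k \<le>o card_of (below A)"
    by (metis cardSuc_least card_of_Card_order card_of_Well_order not_ordLeq_iff_ordLess)
  then have "card_of (Field ?k) \<le>o card_of (below A)"
    by (meson card_of_Card_order cardSuc_Card_order card_of_Field_ordIso ordIso_ordLeq_trans)
  then obtain g where g: "inj_on g (Field ?k)" "g ` Field ?k \<subseteq> below A"
    by (meson card_of_ordLeq)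
  define Z where "Z = g ` Field ?k"
  have Zk: "card_of Z =o ?k"
    using g unfolding Z_def
    by (metis card_of_Card_order cardSuc_Card_order card_of_Field_ordIso card_of_image card_of_ordIsoI
        inj_on_imp_bij_betw ordIso_symmetric ordIso_transitive)
  have "below A \<subseteq> (\<Union>z\<in>Z. {..z})"
  proof
    fix b assume b: "b \<in> below A"
    show "b \<in> (\<Union>z\<in>Z. {..z})"
    proof (rule ccontr)
      assume "b \<notin> (\<Union>z\<in>Z. {..z})"
      then have "Z \<subseteq> {..<b}"
        by (auto simp: not_le)
      then have "card_of Z \<le>o card_of A"
        using b card_of_mono1 ordLeq_transitive unfolding below_def by blast
      then have "?k \<le>o card_of A"
        using Zk ordIso_ordLeq_trans ordIso_symmetric by blast
      then show False
        using cardSuc_greater[OF card_of_Card_order] not_ordLess_ordLeq by blast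
    qed
  qed
  moreover have "card_of (\<Union>z\<in>Z. {..z}) \<le>o card_of Z"
  proof (rule card_of_UNION_ordLeq_infinite)
    have "card_of A \<le>o card_of Z"
      by (metis Zk cardSuc_ordLeq card_of_Card_order ordIso_symmetric ordLeq_ordIso_trans)
    then show "infinite Z" "\<forall>z\<in>Z. card_of {..z} \<le>o card_of Z"
      using assms card_of_ordLeq_finite card_of_atMost_below g(2) ordLeq_transitive
      unfolding Z_def by blast+
  qed (simp only: ordLeq_refl card_of_Card_order)
  ultimately have "card_of (below A) \<le>o card_of Z"
    using card_of_mono1 ordLeq_transitive by blast
  then have "card_of (below A) \<le>o ?k"
    using Zk ordLeq_ordIso_trans by blast
  then show ?thesis
    using ge ordIso_iff_ordLeq by blast
qed

section \<open>Club guessing\<close>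

text \<open>Closedness is stated without referring to limits; as a side effect every club contains the least
  element, so that \<open>drop_to\<close> below is the greatest element of \<open>E\<close> that is at most \<open>x\<close>.\<close>
definition club :: "'t :: wellorder set \<Rightarrow> bool" where
  "club E \<longleftrightarrow> (\<forall>x. \<exists>e\<in>E. x < e) \<and> (\<forall>x. (\<forall>y<x. \<exists>e\<in>E. y < e \<and> e \<le> x) \<longrightarrow> x \<in> E)"

lemma clubI:
  assumes "\<And>x. \<exists>e\<in>E. x < e" "\<And>x. (\<And>y. y < x \<Longrightarrow> \<exists>e\<in>E. y < e \<and> e \<le> x) \<Longrightarrow> x \<in> E"
  shows "club E"
  using assms unfolding club_def by blast

lemma club_unbounded: "club E \<Longrightarrow> \<exists>e\<in>E. x < e"
  unfolding club_def by blast

lemma club_closed: "club E \<Longrightarrow> (\<And>y. y < x \<Longrightarrow> \<exists>e\<in>E. y < e \<and> e \<le> x) \<Longrightarrow> x \<in> E"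
  unfolding club_def by blast

lemma card_of_countable:
  assumes "countable A" "infinite B"
  shows "card_of A \<le>o card_of B"
proof -
  have "card_of A \<le>o card_of (UNIV :: nat set)"
    using assms(1) by (metis card_of_ordLeq countable_def subset_UNIV)
  then show ?thesis
    using assms(2) infinite_iff_card_of_nat ordLeq_transitive by blast
qed

text \<open>Leapfrogging: between \<open>y\<close> and \<open>nx y\<close> lies a point of every
  \<open>E i\<close>, so the supremum of the iterates of \<open>nx\<close> is a limit of each
  \<open>E i\<close> and belongs to all of them.\<close>

lemma club_INT:
  fixes E :: "'i \<Rightarrow> 'u csuc set"
  assumes inf: "infinite (UNIV :: 'u set)" and I: "card_of I \<le>o card_of (UNIV :: 'u set)"
    and club: "\<And>i. i \<in> I \<Longrightarrow> club (E i)"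
  shows "club (\<Inter>i\<in>I. E i)"
proof (rule clubI)
  fix x
  have "\<exists>b>y. \<forall>i\<in>I. \<exists>e\<in>E i. y < e \<and> e < b" for y
  proof -
    have "\<forall>i\<in>I. \<exists>e. e \<in> E i \<and> y < e"
      using club_unbounded[OF club] by blast
    then obtain e where e: "\<And>i. i \<in> I \<Longrightarrow> e i \<in> E i \<and> y < e i"
      by metis
    have "card_of (insert y (e ` I)) \<le>o card_of (UNIV :: 'u set)"
      using inf I card_of_image ordLeq_transitive by (intro card_of_insert_infinite) blast+
    then obtain b where "\<forall>z\<in>insert y (e ` I). z < b"
      using csuc_bounded[OF inf] by blast
    then show ?thesis
      using e by blast
  qed
  then obtain nx where nx: "\<And>y. y < nx y" "\<And>y i. i \<in> I \<Longrightarrow> \<exists>e\<in>E i. y < e \<and> e < nx y"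
    by metis
  define s where "s n = (nx ^^ n) x" for n
  obtain b where b: "\<And>n. s n < b"
    using csuc_bounded[OF inf card_of_countable[OF _ inf], of "range s"] by auto
  define z where "z = (LEAST z. \<forall>n. s n \<le> z)"
  have "\<forall>n. s n \<le> z"
    unfolding z_def by (rule LeastI[of _ b]) (simp add: b less_imp_le)
  then have z: "s n \<le> z" for n ..
  have zE: "z \<in> E i" if i: "i \<in> I" for i
  proof (rule club_closed[OF club[OF i]])
    fix y assume "y < z"
    then obtain n where "y < s n"
      using not_less_Least[of y "\<lambda>z. \<forall>n. s n \<le> z"] unfolding z_def by (auto simp: not_le)
    moreover obtain e where "e \<in> E i" "s n < e" "e < nx (s n)"
      using nx(2)[OF i] by blast
    moreover have "nx (s n) = s (Suc n)"
      by (simp add: s_def)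
    ultimately show "\<exists>e\<in>E i. y < e \<and> e \<le> z"
      using z[of "Suc n"] by (metis less_imp_le less_le_trans less_trans)
  qed
  have "x < z"
    using nx(1)[of x] z[of 1] by (simp add: s_def)
  then show "\<exists>e\<in>\<Inter>i\<in>I. E i. x < e"
    using zE by blast
next
  fix x assume *: "\<And>y. y < x \<Longrightarrow> \<exists>e\<in>\<Inter>i\<in>I. E i. y < e \<and> e \<le> x"
  show "x \<in> (\<Inter>i\<in>I. E i)"
  proof
    fix i assume "i \<in> I"
    then show "x \<in> E i"
      using club_closed[OF club] * by (metis INT_E)
  qed
qed

section \<open>Rounding down to a club\<close>

definition drop_to :: "'t :: wellorder set \<Rightarrow> 't \<Rightarrow> 't" where
  "drop_to E x = (LEAST z. \<forall>e\<in>E. e \<le> x \<longrightarrow> e \<le> z)"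

lemma drop_to_le: "drop_to E x \<le> x"
  unfolding drop_to_def by (rule Least_le) simp

lemma drop_to_greatest: "e \<in> E \<Longrightarrow> e \<le> x \<Longrightarrow> e \<le> drop_to E x"
  unfolding drop_to_def by (rule LeastI2[of _ x]) auto

lemma drop_to_antimono: "E \<subseteq> E' \<Longrightarrow> drop_to E x \<le> drop_to E' x"
  unfolding drop_to_def[of E] by (rule Least_le) (auto intro: drop_to_greatest)

lemma drop_to_mem:
  assumes "club E"
  shows "drop_to E x \<in> E"
proof (rule club_closed[OF assms])
  fix y assume "y < drop_to E x"
  then have "\<not> (\<forall>e\<in>E. e \<le> x \<longrightarrow> e \<le> y)"
    unfolding drop_to_def by (rule not_less_Least)
  then show "\<exists>e\<in>E. y < e \<and> e \<le> drop_to E x"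
    using drop_to_greatest by (metis not_le)
qed

text \<open>\<open>a\<close> has cofinality \<open>\<omega>\<^sub>1\<close>, witnessed by the cofinal set \<open>c\<close>.\<close>
definition om1_limit :: "'t :: wellorder \<Rightarrow> 't set \<Rightarrow> bool" where
  "om1_limit a c \<longleftrightarrow> c \<subseteq> {..<a} \<and> card_of c \<le>o card_of (UNIV :: nat csuc set) \<and>
     (\<forall>b<a. \<exists>x\<in>c. b < x) \<and> (\<forall>Z\<subseteq>{..<a}. countable Z \<longrightarrow> (\<exists>b<a. \<forall>z\<in>Z. z \<le> b))"

text \<open>The point \<open>a\<close> is the supremum of a strictly increasing
  \<open>\<omega>\<^sub>1\<close>-sequence chosen from \<open>E\<close>. Countable subsets are
  bounded below \<open>a\<close> because \<open>\<omega>\<^sub>1\<close> is regular.\<close>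

lemma ex_om1_limit:
  fixes E :: "nat csuc csuc csuc set"
  assumes "club E"
  shows "\<exists>a c. om1_limit a c \<and> (\<forall>b<a. \<exists>e\<in>E. b < e \<and> e < a)"
proof -
  let ?P = "\<lambda>f (i :: nat csuc) r. r \<in> E \<and> (\<forall>j<i. f j < r)"
  have inf: "infinite (UNIV :: nat csuc csuc set)"
    by (simp add: infinite_UNIV_csuc)
  have bdd: "\<exists>b. \<forall>z\<in>f ` Z. z < b" for f :: "nat csuc \<Rightarrow> nat csuc csuc csuc" and Z
  proof (rule csuc_bounded[OF inf])
    have "card_of (f ` Z) \<le>o card_of (UNIV :: nat csuc set)"
      using card_of_image card_of_mono1 ordLeq_transitive subset_UNIV by metis
    then show "card_of (f ` Z) \<le>o card_of (UNIV :: nat csuc csuc set)"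
      using card_of_UNIV_less_csuc ordLeq_transitive ordLess_imp_ordLeq by blast
  qed
  have "\<exists>f. \<forall>i. ?P f i (f i)"
  proof (rule dependent_wf_choice[OF wf])
    fix i and f :: "nat csuc \<Rightarrow> nat csuc csuc csuc"
    obtain b where "\<forall>j<i. f j < b"
      using bdd[of f "{..<i}"] by auto
    moreover obtain e where "e \<in> E" "b < e"
      using club_unbounded[OF assms] by blast
    ultimately show "\<exists>r. ?P f i r"
      by (meson less_trans)
  qed auto
  then obtain f :: "nat csuc \<Rightarrow> nat csuc csuc csuc" where f: "\<And>i. f i \<in> E" "\<And>i j. j < i \<Longrightarrow> f j < f i"
    by blast
  define a where "a = (LEAST a. \<forall>i. f i < a)"
  have "\<forall>i. f i < a"
    unfolding a_def by (rule LeastI_ex) (use bdd[of f UNIV] in auto)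
  then have fa: "f i < a" for i ..
  have nxt: "\<exists>j. i < j" for i :: "nat csuc"
    using csuc_bounded[OF infinite_UNIV_nat, of "{i}"] card_of_countable[of "{i}" "UNIV :: nat set"] by auto
  have cof: "\<exists>i. b < f i" if b: "b < a" for b
  proof -
    obtain i where "b \<le> f i"
      using not_less_Least[of b "\<lambda>a. \<forall>i. f i < a"] b unfolding a_def by (auto simp: not_less)
    moreover obtain j where "i < j"
      using nxt by blast
    ultimately show ?thesis
      using f(2) le_less_trans by blast
  qed
  have "\<exists>b<a. \<forall>z\<in>Z. z \<le> b" if Z: "Z \<subseteq> {..<a}" "countable Z" for Z
  proof -
    obtain g where g: "\<And>z. z \<in> Z \<Longrightarrow> z < f (g z)"
      using cof Z(1) by (metis lessThan_iff subsetD)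
    obtain k where "\<forall>i\<in>g ` Z. i < k"
      using csuc_bounded[OF infinite_UNIV_nat card_of_countable] Z(2) by (metis countable_image infinite_UNIV_nat)
    then have "\<forall>z\<in>Z. z \<le> f k"
      using g f(2) by (meson imageI less_imp_le less_trans)
    then show ?thesis
      using fa by blast
  qed
  then have "om1_limit a (range f)"
    unfolding om1_limit_def using fa cof card_of_image by auto
  moreover have "\<forall>b<a. \<exists>e\<in>E. b < e \<and> e < a"
    using cof fa f(1) by blast
  ultimately show ?thesis by blast
qed

text \<open>Shelah's club guessing for \<open>\<omega>\<^sub>3\<close> and cofinality \<open>\<omega>\<^sub>1\<close>: if no club \<open>E\<close> made \<open>a \<mapsto> drop_to E ` c a\<close> a guessing
  sequence, iterate the counterexamples \<open>\<omega>\<^sub>2\<close> times.\<close>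
theorem club_guessing:
  "\<exists>C :: nat csuc csuc csuc \<Rightarrow> nat csuc csuc csuc set.
     \<forall>E. club E \<longrightarrow> (\<exists>a. C a \<subseteq> E \<and> uncountable (C a))"
proof (rule ccontr)
  assume no: "\<not> ?thesis"
  define c :: "nat csuc csuc csuc \<Rightarrow> nat csuc csuc csuc set" where "c a = (SOME c. om1_limit a c)" for a
  have "\<forall>E. \<exists>E'. club E' \<and> \<not> (\<exists>a. drop_to E ` c a \<subseteq> E' \<and> uncountable (drop_to E ` c a))"
  proof (rule ccontr)
    assume "\<not> ?thesis"
    then obtain E where "\<not> (\<exists>E'. club E' \<and>
        \<not> (\<exists>a. drop_to E ` c a \<subseteq> E' \<and> uncountable (drop_to E ` c a)))"
      unfolding not_all ..
    then have "\<forall>E'. club E' \<longrightarrow> (\<exists>a. drop_to E ` c a \<subseteq> E' \<and> uncountable (drop_to E ` c a))"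
      by simp
    then have "\<exists>C :: nat csuc csuc csuc \<Rightarrow> nat csuc csuc csuc set. \<forall>E'. club E' \<longrightarrow> (\<exists>a. C a \<subseteq> E' \<and> uncountable (C a))"
      by (rule exI[of _ "\<lambda>a. drop_to E ` c a"])
    with no show False ..
  qed
  from choice[OF this] obtain F where "\<forall>E. club (F E) \<and>
      \<not> (\<exists>a. drop_to E ` c a \<subseteq> F E \<and> uncountable (drop_to E ` c a))" ..
  then have F: "club (F E)" "drop_to E ` c a \<subseteq> F E \<Longrightarrow> countable (drop_to E ` c a)" for E a
    by simp_all
  \<comment> \<open>Stage \<open>i\<close> intersects all earlier clubs with their counterexamples.
    There are fewer than \<open>\<omega>\<^sub>3\<close> stages, so the intersections remain
    clubs.\<close>
  let ?P = "\<lambda>G (i :: nat csuc csuc) r. r = (\<Inter>j\<in>{..<i}. G j \<inter> F (G j))"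
  have "\<exists>G. \<forall>i. ?P G i (G i)"
  proof (rule dependent_wf_choice[OF wf])
    fix f g :: "nat csuc csuc \<Rightarrow> nat csuc csuc csuc set" and i r
    assume "\<And>j. (j, i) \<in> {(x, y). x < y} \<Longrightarrow> f j = g j"
    then have "(\<Inter>j\<in>{..<i}. f j \<inter> F (f j)) = (\<Inter>j\<in>{..<i}. g j \<inter> F (g j))"
      by (intro INF_cong) simp_all
    then show "?P f i r = ?P g i r"
      by (simp only:)
  qed (rule exI, rule refl)
  then obtain G :: "nat csuc csuc \<Rightarrow> nat csuc csuc csuc set" where G: "\<And>i. G i = (\<Inter>j\<in>{..<i}. G j \<inter> F (G j))"
    by blast
  have inf: "infinite (UNIV :: nat csuc csuc set)"
    by (simp add: infinite_UNIV_csuc)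
  have clubG: "club (G i)" for i
  proof (induction i rule: less_induct)
    case (less i)
    have "club (G j \<inter> F (G j))" if "j < i" for j
    proof -
      have "club (\<Inter>X\<in>{G j, F (G j)}. X)"
        using less[OF that] F(1) by (intro club_INT[OF inf card_of_countable[OF _ inf]]) auto
      then show ?thesis by simp
    qed
    then have "club (\<Inter>j\<in>{..<i}. G j \<inter> F (G j))"
      by (intro club_INT[OF inf]) (auto intro: card_of_mono1)
    then show ?case
      using G[of i] by simp
  qed
  define E where "E = (\<Inter>i. G i)"
  have "club E"
    unfolding E_def by (rule club_INT[OF inf _ clubG]) (auto intro: card_of_mono1)
  then obtain a c' where "om1_limit a c'" and lim: "\<forall>b<a. \<exists>e\<in>E. b < e \<and> e < a"
    using ex_om1_limit by blast
  then have a: "om1_limit a (c a)"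
    unfolding c_def by (metis someI)
  have a_bdd: "\<And>Z. Z \<subseteq> {..<a} \<Longrightarrow> countable Z \<Longrightarrow> \<exists>b<a. \<forall>z\<in>Z. z \<le> b"
    and a_cof: "\<And>b. b < a \<Longrightarrow> \<exists>x\<in>c a. b < x"
    using a unfolding om1_limit_def by simp_all
  have mono: "G j \<subseteq> G i \<inter> F (G i)" if "i < j" for i j
    using G[of j] that by blast
  text \<open>For fixed \<open>x\<close> the values \<open>drop_to (G i) x\<close> decrease in a well-order, hence stabilise.\<close>
  have "\<exists>i. \<forall>j\<ge>i. drop_to (G j) x = drop_to (G i) x" for x
  proof -
    define v where "v = (LEAST v. \<exists>i. v = drop_to (G i) x)"
    obtain i where i: "v = drop_to (G i) x"
      unfolding v_def using LeastI_ex[of "\<lambda>v. \<exists>i. v = drop_to (G i) x"] by blast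
    have "drop_to (G j) x = drop_to (G i) x" if "i \<le> j" for j
    proof (rule antisym)
      have "G j \<subseteq> G i"
        using that mono[of i j] le_neq_trans[of i j] by blast
      then show "drop_to (G j) x \<le> drop_to (G i) x"
        by (rule drop_to_antimono)
      show "drop_to (G i) x \<le> drop_to (G j) x"
        unfolding i[symmetric] v_def by (rule Least_le) blast
    qed
    then show ?thesis by blast
  qed
  then obtain s where s: "\<And>x j. s x \<le> j \<Longrightarrow> drop_to (G j) x = drop_to (G (s x)) x"
    by metis
  have "card_of (s ` c a) \<le>o card_of (UNIV :: nat csuc set)"
    using a by (intro ordLeq_transitive[OF card_of_image]) (simp add: om1_limit_def)
  \<comment> \<open>The set \<open>c a\<close> has at most \<open>\<omega>\<^sub>1\<close> points,
    so by regularity of \<open>\<omega>\<^sub>2\<close> one stage lies past all their stabilisation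
    stages.\<close>
  then obtain i where i: "\<forall>x\<in>c a. s x < i"
    using csuc_bounded[of "s ` c a"] infinite_UNIV_csuc[OF infinite_UNIV_nat] by auto
  obtain j where "i < j"
    using csuc_bounded[of "{i}"] card_of_countable[of "{i}" "UNIV :: nat csuc set"]
      infinite_UNIV_csuc[OF infinite_UNIV_nat] by auto
  \<comment> \<open>The value no longer changes after stage \<open>i\<close>, so it also lies in the
    later club \<open>G j\<close>, which is contained in \<open>F (G i)\<close>. Thus the guess at
    \<open>a\<close> succeeds, and the choice of \<open>F\<close> forces it to be countable.\<close>
  have "drop_to (G i) x \<in> F (G i)" if "x \<in> c a" for x
  proof -
    have "drop_to (G i) x = drop_to (G j) x"
      using s[of x i] s[of x j] i that \<open>i < j\<close> by (metis less_imp_le less_trans)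
    then show ?thesis
      using drop_to_mem[OF clubG, of j x] mono[OF \<open>i < j\<close>] by auto
  qed
  then have "countable (drop_to (G i) ` c a)"
    by (intro F(2)) blast
  moreover have "drop_to (G i) ` c a \<subseteq> {..<a}"
    using a le_less_trans[OF drop_to_le] unfolding om1_limit_def by auto
  ultimately obtain b where b: "b < a" "\<And>x. x \<in> c a \<Longrightarrow> drop_to (G i) x \<le> b"
    using a_bdd[of "drop_to (G i) ` c a"] by auto
  \<comment> \<open>A countable guess is bounded by some \<open>b < a\<close>; but \<open>E\<close>
    has elements between \<open>b\<close> and \<open>a\<close>, and a point of \<open>c a\<close>
    beyond such an element is rounded down to something above \<open>b\<close>.\<close>
  obtain e where e: "e \<in> E" "b < e" "e < a"
    using lim b(1) by blast
  obtain x where x: "x \<in> c a" "e < x"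
    using a_cof[OF e(3)] by blast
  have "e \<le> drop_to (G i) x"
    using e(1) x(2) unfolding E_def by (intro drop_to_greatest) auto
  then show False
    using b(2)[OF x(1)] e(2) by simp
qed

section \<open>Functions increasing modulo finite\<close>

text \<open>The \<open>f d\<close> are increasing modulo finite. An \<open>\<omega>\<^sub>3\<close>-sequence \<open>x i < y i\<close> is built, \<open>x\<close> continuous and \<open>y i \<in> Y\<close>,
  such that \<open>y i\<close> eventually dominates, uniformly, those sets \<open>x ` (C a \<inter> {..i})\<close> that can be so dominated at
  all. At the supremum \<open>d\<close> some \<open>B d n\<close> captures \<open>x\<close> on a club, so a guess \<open>C a\<close> inside that club can always be
  dominated. Uncountably many indices of \<open>C a\<close> share the bound from which domination holds.\<close>
lemma uncountable_value_set:
  fixes L :: "'a set" and f :: "'a csuc \<Rightarrow> nat \<Rightarrow> 'b :: order" and B :: "'a csuc \<Rightarrow> nat \<Rightarrow> 'a csuc set"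
  assumes inf: "infinite L" and om3: "card_of (UNIV :: nat csuc csuc csuc set) \<le>o card_of L"
    and mono: "\<And>d m n. m \<le> n \<Longrightarrow> B d m \<subseteq> B d n"
    and cover: "\<And>d x. d \<in> below L \<Longrightarrow> x < d \<Longrightarrow> \<exists>n. x \<in> B d n"
    and closed: "\<And>d n x. x < d \<Longrightarrow> (\<And>y. y < x \<Longrightarrow> \<exists>b\<in>B d n. y < b \<and> b \<le> x) \<Longrightarrow> x \<in> B d n"
    and f: "\<And>d n x. d \<in> below L \<Longrightarrow> x \<in> B d n \<Longrightarrow> f x n < f d n"
    and Y: "Y \<subseteq> below L" "\<And>x. x \<in> below L \<Longrightarrow> \<exists>y\<in>Y. x < y"
  shows "\<exists>n. uncountable ((\<lambda>y. f y n) ` Y)"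
proof -
  \<comment> \<open>\<open>f s\<close> dominates all \<open>f z\<close> with \<open>z\<close> in
    \<open>Z\<close> from one common coordinate on.\<close>
  define cap where "cap Z s \<longleftrightarrow> (\<exists>n0. \<forall>n\<ge>n0. \<forall>z\<in>Z. f z n < f s n)" for Z s
  have less: "\<exists>n0. \<forall>n\<ge>n0. f z n < f s n" if "s \<in> below L" "z < s" for z s
    using cover[OF that] mono f[OF that(1)] by blast
  have cap_less: "cap Z t" if Z: "cap Z s" and t: "t \<in> below L" "s < t" for Z s t
  proof -
    obtain k where k: "\<And>n z. k \<le> n \<Longrightarrow> z \<in> Z \<Longrightarrow> f z n < f s n"
      using Z unfolding cap_def by blast
    obtain l where "\<And>n. l \<le> n \<Longrightarrow> f s n < f t n"
      using less[OF t] by blast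
    then have "\<forall>n\<ge>max k l. \<forall>z\<in>Z. f z n < f t n"
      using k by (meson less_trans max.bounded_iff)
    then show ?thesis
      unfolding cap_def by blast
  qed

  \<comment> \<open>Recursive choice of the interleaved sequences\<close>
  obtain C :: "nat csuc csuc csuc \<Rightarrow> nat csuc csuc csuc set"
    where C: "\<And>E. club E \<Longrightarrow> \<exists>a. C a \<subseteq> E \<and> uncountable (C a)"
    using club_guessing by blast
  \<comment> \<open>The supremum of the earlier values of \<open>y\<close>; taking suprema at every
    stage is what makes \<open>x\<close> continuous.\<close>
  define xi :: "(nat csuc csuc csuc \<Rightarrow> 'a csuc) \<Rightarrow> nat csuc csuc csuc \<Rightarrow> 'a csuc"
    where "xi y i = (LEAST x. \<forall>j<i. y j \<le> x)" for y i
  define P where "P y i r \<longleftrightarrow> r \<in> Y \<and> xi y i < r \<and>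
    (\<forall>a. \<forall>s\<in>below L. cap (xi y ` (C a \<inter> {..i})) s \<longrightarrow> cap (xi y ` (C a \<inter> {..i})) r)" for y i r
  have small: "card_of (g ` Z) \<le>o card_of L" for g :: "nat csuc csuc csuc \<Rightarrow> 'a csuc" and Z
    using card_of_image card_of_mono1[OF subset_UNIV] om3 ordLeq_transitive by metis
  have xi_below: "xi y i \<in> below L" and xi_upper: "\<And>j. j < i \<Longrightarrow> y j \<le> xi y i"
    if "\<And>j. j < i \<Longrightarrow> y j \<in> below L" for y i
  proof -
    have "y ` {..<i} \<subseteq> below L"
      using that by blast
    then obtain b where b: "b \<in> below L" "\<forall>z\<in>y ` {..<i}. z < b"
      using below_bounded[OF inf _ small] by blast
    then have "\<forall>j<i. y j \<le> b"
      by (simp add: less_imp_le)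
    then have "\<forall>j<i. y j \<le> xi y i" "xi y i \<le> b"
      unfolding xi_def by (rule LeastI, rule Least_le)
    then show "xi y i \<in> below L" "\<And>j. j < i \<Longrightarrow> y j \<le> xi y i"
      using below_downward[OF b(1)] by blast+
  qed
  have "\<exists>y. \<forall>i. P y i (y i)"
  proof (rule dependent_wf_choice[OF wf])
    fix y y' :: "nat csuc csuc csuc \<Rightarrow> 'a csuc" and i r
    assume eq: "\<And>j. (j, i) \<in> {(x, y). x < y} \<Longrightarrow> y j = y' j"
    have xi: "xi y k = xi y' k" if "k \<le> i" for k
    proof -
      have "(\<lambda>x. \<forall>j<k. y j \<le> x) = (\<lambda>x. \<forall>j<k. y' j \<le> x)"
        using eq that by (auto simp: fun_eq_iff)
      then show ?thesis
        unfolding xi_def by (simp only:)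
    qed
    have "xi y ` (C a \<inter> {..i}) = xi y' ` (C a \<inter> {..i})" for a
      using xi by (intro image_cong) auto
    then show "P y i r = P y' i r"
      unfolding P_def using xi[OF order_refl] by simp
  next
    fix i and y :: "nat csuc csuc csuc \<Rightarrow> 'a csuc"
    assume prev: "\<And>j. (j, i) \<in> {(x, y). x < y} \<Longrightarrow> P y j (y j)"
    have "y j \<in> below L" if "j < i" for j
      using prev that Y(1) unfolding P_def by blast
    then have xib: "xi y i \<in> below L"
      by (rule xi_below)
    \<comment> \<open>One dominating point for each index \<open>a\<close> that admits one;
      \<open>xi y i\<close> is merely a default inside \<open>below L\<close>. There are at most
      \<open>|L|\<close> indices, so some \<open>r\<close> in \<open>Y\<close> exceeds all these
      points and dominates whatever they dominate.\<close>
    define s where "s a = (if \<exists>s\<in>below L. cap (xi y ` (C a \<inter> {..i})) s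
      then SOME s. s \<in> below L \<and> cap (xi y ` (C a \<inter> {..i})) s else xi y i)" for a
    have s: "s a \<in> below L \<and> cap (xi y ` (C a \<inter> {..i})) (s a)"
      if "t \<in> below L" "cap (xi y ` (C a \<inter> {..i})) t" for a t
      unfolding s_def using that someI[of "\<lambda>s. s \<in> below L \<and> cap (xi y ` (C a \<inter> {..i})) s" t] by auto
    have "s a \<in> below L" for a
    proof (cases "\<exists>t\<in>below L. cap (xi y ` (C a \<inter> {..i})) t")
      case True
      then show ?thesis using s by blast
    next
      case False
      then show ?thesis using xib by (simp add: s_def)
    qed
    then have "insert (xi y i) (range s) \<subseteq> below L"
      using xib by blast
    moreover have "card_of (insert (xi y i) (range s)) \<le>o card_of L"
      by (intro card_of_insert_infinite inf small)
    ultimately obtain b where b: "b \<in> below L" "\<forall>z\<in>insert (xi y i) (range s). z < b"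
      using below_bounded[OF inf] by blast
    obtain r where r: "r \<in> Y" "b < r"
      using Y(2) b(1) by blast
    have "cap (xi y ` (C a \<inter> {..i})) r" if "t \<in> below L" "cap (xi y ` (C a \<inter> {..i})) t" for a t
    proof (rule cap_less)
      show "cap (xi y ` (C a \<inter> {..i})) (s a)"
        using s[OF that] by blast
      show "r \<in> below L" "s a < r"
        using r b(2) Y(1) by (auto intro: less_trans)
    qed
    moreover have "xi y i < r"
      using b(2) r(2) by (auto intro: less_trans)
    ultimately show "\<exists>r. P y i r"
      unfolding P_def using r(1) by blast
  qed
  then obtain y where y: "\<And>i. P y i (y i)"
    by blast
  define x where "x = xi y"
  have yY: "y i \<in> Y" and x_less_y: "x i < y i"
    and cap_y: "\<And>a s. s \<in> below L \<Longrightarrow> cap (x ` (C a \<inter> {..i})) s \<Longrightarrow> cap (x ` (C a \<inter> {..i})) (y i)" for i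
    using y[of i] unfolding P_def x_def by blast+
  have x_below: "x i \<in> below L" and y_le_x: "\<And>j. j < i \<Longrightarrow> y j \<le> x i" for i
    using xi_below[of i y] xi_upper[of i y] yY Y(1) unfolding x_def by blast+
  have x_mono: "x i \<le> x j" if "i \<le> j" for i j
    using that x_less_y[of i] y_le_x[of i j] le_neq_trans[of i j] by (cases "i = j") auto
  have x_least: "\<exists>j<i. z < y j" if z: "z < x i" for z i
    using not_less_Least[of z "\<lambda>x. \<forall>j<i. y j \<le> x"] z unfolding x_def xi_def by (auto simp: not_le)

  \<comment> \<open>Capturing the sequence on a club\<close>
  have "range x \<subseteq> below L"
    using x_below by blast
  then obtain d where d: "d \<in> below L" "\<And>i. x i < d"
    using below_bounded[OF inf _ small] by (metis rangeI)
  define D where "D n = {i. x i \<in> B d n}" for n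
  have om3_bounded: "\<exists>b. \<forall>z\<in>Z. z < b" if "countable Z" for Z :: "nat csuc csuc csuc set"
    by (rule csuc_bounded[OF _ card_of_countable[OF that]]) (simp_all add: infinite_UNIV_csuc)
  \<comment> \<open>Bounds for all the countably many \<open>D n\<close> would have a common strict
    upper bound \<open>b\<close>, yet \<open>x b\<close> lies in some \<open>B d n\<close>.\<close>
  have "\<exists>n. \<forall>k. \<exists>i\<in>D n. k < i"
  proof (rule ccontr)
    assume "\<not> ?thesis"
    then have "\<forall>n. \<exists>k. \<forall>i\<in>D n. \<not> k < i"
      by simp
    then obtain k where k: "\<And>n i. i \<in> D n \<Longrightarrow> \<not> k n < i"
      by metis
    obtain b where b: "\<And>n. k n < b"
      using om3_bounded[of "range k"] by auto
    obtain n where "b \<in> D n"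
      using cover[OF d] unfolding D_def by blast
    then show False
      using k b by blast
  qed
  then obtain n where unb: "\<And>k. \<exists>i\<in>D n. k < i"
    by blast
  \<comment> \<open>Continuity of \<open>x\<close> carries limits of \<open>D n\<close> to limits of
    \<open>B d n\<close>, which is closed below \<open>d\<close>.\<close>
  have D_club: "club (D n)"
  proof (rule clubI)
    fix i assume lim: "\<And>j. j < i \<Longrightarrow> \<exists>e\<in>D n. j < e \<and> e \<le> i"
    have "x i \<in> B d n"
    proof (rule closed[OF d(2)])
      fix z assume "z < x i"
      then obtain j where j: "j < i" "z < y j"
        using x_least by blast
      then obtain e where "e \<in> D n" "j < e" "e \<le> i"
        using lim by blast
      then show "\<exists>b\<in>B d n. z < b \<and> b \<le> x i"
        using j(2) y_le_x[of j e] x_mono[of e i] unfolding D_def by (blast intro: less_le_trans)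
    qed
    then show "i \<in> D n"
      unfolding D_def by simp
  qed (rule unb)
  obtain a where a: "C a \<subseteq> D n" "uncountable (C a)"
    using C[OF D_club] by (elim exE conjE)
  \<comment> \<open>Since \<open>C a\<close> lies inside \<open>D n\<close>, the point
    \<open>d\<close> itself witnesses that these sets can be dominated, from coordinate
    \<open>n\<close> on. The recursion then makes \<open>y i\<close> dominate them.\<close>
  have "cap (x ` (C a \<inter> {..i})) d" for i
  proof -
    have "f (x j) m < f d m" if "n \<le> m" "j \<in> C a" for m j
      using a(1) mono[OF that(1), of d] that(2) by (intro f[OF d(1)]) (auto simp: D_def)
    then show ?thesis
      unfolding cap_def by (intro exI[of _ n]) auto
  qed
  then have "cap (x ` (C a \<inter> {..i})) (y i)" for i
    using cap_y d(1) by blast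
  then have "\<forall>i. \<exists>k. \<forall>n\<ge>k. \<forall>j\<in>C a \<inter> {..i}. f (x j) n < f (y i) n"
    unfolding cap_def by simp
  then obtain k where k: "\<And>i j n. k i \<le> n \<Longrightarrow> j \<in> C a \<Longrightarrow> j \<le> i \<Longrightarrow> f (x j) n < f (y i) n"
    by (metis Int_iff atMost_iff)

  \<comment> \<open>Thinning to an uncountable set with increasing values\<close>
  define C' where "C' = {i \<in> C a. \<exists>j\<in>C a. i < j}"
  define nx where "nx i = (LEAST j. j \<in> C a \<and> i < j)" for i
  have nx: "nx i \<in> C a" "i < nx i" if "i \<in> C'" for i
    using that LeastI_ex[of "\<lambda>j. j \<in> C a \<and> i < j"] unfolding C'_def nx_def by blast+
  have nx_le: "nx i \<le> j" if "j \<in> C a" "i < j" for i j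
    unfolding nx_def by (rule Least_le) (use that in simp)
  have "\<exists>l. \<forall>n\<ge>l. f (y i) n \<le> f (x (nx i)) n" if "i \<in> C'" for i
  proof (cases "y i = x (nx i)")
    case False
    then have "y i < x (nx i)"
      using y_le_x[OF nx(2)[OF that]] by simp
    then show ?thesis
      using less[OF x_below] less_imp_le by meson
  qed simp
  then obtain l where l: "\<And>i n. i \<in> C' \<Longrightarrow> l i \<le> n \<Longrightarrow> f (y i) n \<le> f (x (nx i)) n"
    by metis
  \<comment> \<open>Only a greatest element of \<open>C a\<close> lacks a next element, so passing
    to \<open>C'\<close> loses at most one point.\<close>
  have "C a - C' \<subseteq> {LEAST i. i \<in> C a - C'}"
  proof
    fix i assume i: "i \<in> C a - C'"
    then have "(LEAST i. i \<in> C a - C') \<in> C a - C'"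
      by (rule LeastI)
    then show "i \<in> {LEAST i. i \<in> C a - C'}"
      using i Least_le[of "\<lambda>i. i \<in> C a - C'" i] by (auto simp: C'_def le_less)
  qed
  then have "countable (C a - C')"
    by (rule countable_subset) simp
  then have "uncountable C'"
    using a(2) countable_Un[of "C a - C'" C'] countable_subset[of "C a" "(C a - C') \<union> C'"] by auto
  moreover have "C' = (\<Union>m. {i \<in> C'. max (k i) (l i) = m})"
    by blast
  ultimately obtain m where m: "uncountable {i \<in> C'. max (k i) (l i) = m}"
    using countable_UN[of UNIV "\<lambda>m. {i \<in> C'. max (k i) (l i) = m}"] by auto
  define U where "U = {i \<in> C'. max (k i) (l i) = m}"
  \<comment> \<open>The point \<open>x (nx i)\<close> interpolates: it is at or above
    \<open>y i\<close>, and as \<open>nx i \<le> j\<close> it is among the points dominated by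
    \<open>y j\<close>.\<close>
  have incr: "f (y i) m < f (y j) m" if "i \<in> U" "j \<in> U" "i < j" for i j
  proof -
    have "f (y i) m \<le> f (x (nx i)) m"
      using l[of i m] that(1) unfolding U_def by auto
    also have "\<dots> < f (y j) m"
      using k[of j m "nx i"] nx(1)[of i] nx_le[of j i] that unfolding U_def C'_def by auto
    finally show ?thesis .
  qed
  have "inj_on (\<lambda>i. f (y i) m) U"
  proof (rule inj_onI)
    fix i j assume "i \<in> U" "j \<in> U" "f (y i) m = f (y j) m"
    then show "i = j"
      using incr[of i j] incr[of j i] by (cases i j rule: linorder_cases) auto
  qed
  then have "uncountable ((\<lambda>i. f (y i) m) ` U)"
    using m countable_image_inj_on unfolding U_def by blast
  moreover have "(\<lambda>i. f (y i) m) ` U \<subseteq> (\<lambda>y. f y m) ` Y"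
    using yY by blast
  ultimately show ?thesis
    using countable_subset by blast
qed

section \<open>Sparse families of functions\<close>

text \<open>Closure in the order topology together with the least element, matching the notion of
  closedness in \<open>club\<close>.\<close>

definition order_closure :: "'t :: wellorder set \<Rightarrow> 't set" where
  "order_closure A = {x. \<forall>y<x. \<exists>b\<in>A. y < b \<and> b \<le> x}"

lemma subset_order_closure: "A \<subseteq> order_closure A"
  unfolding order_closure_def by blast

lemma order_closure_mono: "A \<subseteq> A' \<Longrightarrow> order_closure A \<subseteq> order_closure A'"
  unfolding order_closure_def by blast

lemma order_closure_closed:
  assumes "\<And>y. y < x \<Longrightarrow> \<exists>b\<in>order_closure A. y < b \<and> b \<le> x"
  shows "x \<in> order_closure A"
  unfolding order_closure_def
proof safe
  fix y assume "y < x"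
  then obtain b where "b \<in> order_closure A" "y < b" "b \<le> x"
    using assms by blast
  moreover from this obtain a where "a \<in> A" "y < a" "a \<le> b"
    unfolding order_closure_def by blast
  ultimately show "\<exists>b\<in>A. y < b \<and> b \<le> x"
    by (meson order_trans)
qed

text \<open>A point of the closure is determined by the next element of \<open>A\<close> above it, if there is one.\<close>
lemma card_of_order_closure:
  assumes "infinite B" "card_of A \<le>o card_of B"
  shows "card_of (order_closure A) \<le>o card_of B"
proof -
  define T where "T = {x \<in> order_closure A. \<exists>a\<in>A. x < a}"
  define nx where "nx x = (LEAST a. a \<in> A \<and> x < a)" for x
  have nx: "nx x \<in> A" "x < nx x" if "x \<in> T" for x
    using that LeastI_ex[of "\<lambda>a. a \<in> A \<and> x < a"] unfolding T_def nx_def by blast+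
  have between: "\<exists>b\<in>A. x < b \<and> b \<le> x'" if "x < x'" "x' \<in> order_closure A" for x x'
    using that unfolding order_closure_def by blast
  have less: "nx x < nx x'" if "x < x'" "x \<in> T" "x' \<in> T" for x x'
  proof -
    obtain b where "b \<in> A" "x < b" "b \<le> x'"
      using between \<open>x < x'\<close> \<open>x' \<in> T\<close> unfolding T_def by blast
    moreover from this have "nx x \<le> b"
      unfolding nx_def by (intro Least_le) simp
    ultimately have "nx x \<le> x'"
      by simp
    then show ?thesis
      using nx(2)[OF \<open>x' \<in> T\<close>] by simp
  qed
  have "inj_on nx T"
  proof (rule inj_onI)
    fix x x' assume "x \<in> T" "x' \<in> T" "nx x = nx x'"
    then show "x = x'"
      using less[of x x'] less[of x' x] by (cases x x' rule: linorder_cases) auto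
  qed
  then have "card_of T \<le>o card_of A"
    using nx(1) card_of_ordLeqI by blast
  then have "card_of T \<le>o card_of B"
    using assms(2) by (rule ordLeq_transitive)
  then have insT: "card_of (insert z T) \<le>o card_of B" for z
    by (rule card_of_insert_infinite[OF assms(1)])
  \<comment> \<open>Two points of the closure have an element of \<open>A\<close> above the smaller
    one, so at most one point falls outside \<open>T\<close>.\<close>
  have "\<exists>z. order_closure A \<subseteq> insert z T"
  proof (cases "order_closure A \<subseteq> T")
    case False
    then obtain z where z: "z \<in> order_closure A" "z \<notin> T" by blast
    have "x = z" if "x \<in> order_closure A" "x \<notin> T" for x
      using between[of x z] between[of z x] that z unfolding T_def
      by (cases x z rule: linorder_cases) auto
    then show ?thesis by blast
  qed blast
  then obtain z where "order_closure A \<subseteq> insert z T" ..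
  then show ?thesis
    by (rule ordLeq_transitive[OF card_of_mono1 insT])
qed

text \<open>\<open>A n\<close> collects the segments below the first points of an enumeration of the
  cofinal set. A countably infinite set is added to make every \<open>A n\<close> infinite; it has
  size below \<open>|L|\<close> because \<open>L\<close> is uncountable.\<close>

lemma countable_exhaustion:
  assumes inf: "infinite L" and unc: "natLeq <o card_of L"
    and K: "K \<subseteq> L" "cofinal K (card_of L)" "countable K"
  shows "\<exists>A. (\<forall>n. infinite (A n) \<and> card_of (A n) <o card_of L) \<and>
    mono A \<and> L \<subseteq> (\<Union>n :: nat. A n)"
proof -
  obtain N where N: "N \<subseteq> L" "infinite N" "countable N"
    using infinite_countable_subset'[OF inf] by blast
  have "L \<noteq> {}"
    using inf by auto
  then have "K \<noteq> {}"
    using K(2) unfolding cofinal_def by (auto simp: Field_card_of)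
  define k where "k = from_nat_into K"
  have range_k: "range k = K"
    unfolding k_def using range_from_nat_into[OF \<open>K \<noteq> {}\<close> K(3)] .
  define A where "A n = N \<union> (\<Union>i\<le>n. underS (card_of L) (k i))" for n :: nat
  have "card_of N \<le>o card_of (UNIV :: nat set)"
    using N(3) by (intro card_of_countable) auto
  then have cN: "card_of N <o card_of L"
    using card_of_nat unc ordLeq_ordIso_trans ordLeq_ordLess_trans by blast
  have under: "card_of (underS (card_of L) (k i)) <o card_of L" for i
    using K(1) range_k by (intro card_of_underS card_of_Card_order) (auto simp: Field_card_of)
  have "card_of (\<Union>i\<le>n. underS (card_of L) (k i)) <o card_of L" for n :: nat
  proof (induction n)
    case 0
    then show ?case using under by simp
  next
    case (Suc n)
    then show ?case
      using card_of_Un_ordLess_infinite[OF inf under[of "Suc n"] Suc] by (simp add: atMost_Suc)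
  qed
  then have "card_of (A n) <o card_of L" for n
    unfolding A_def by (rule card_of_Un_ordLess_infinite[OF inf cN])
  moreover have "infinite (A n)" for n
    unfolding A_def using N(2) by simp
  moreover have "mono A"
    unfolding A_def by (rule monoI) fastforce
  moreover have "L \<subseteq> (\<Union>n. A n)"
  proof
    fix x assume "x \<in> L"
    then obtain b where "b \<in> K" "x \<noteq> b" "(x, b) \<in> card_of L"
      using K(2) unfolding cofinal_def by (auto simp: Field_card_of)
    then obtain n where "x \<in> underS (card_of L) (k n)"
      using range_k unfolding underS_def by blast
    then show "x \<in> (\<Union>n. A n)"
      unfolding A_def by blast
  qed
  ultimately show ?thesis by blast
qed

text \<open>The zeroth coordinate of \<open>g\<close> only serves to make the tree of initial segments have size \<open>|L|\<close>.\<close>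
lemma ex_sparse_functions:
  fixes L :: "'a set"
  assumes inf: "infinite L" and om3: "card_of (UNIV :: nat csuc csuc csuc set) \<le>o card_of L"
    and A: "\<And>n :: nat. infinite (A n)" "\<And>n. card_of (A n) <o card_of L"
      "mono A" "L \<subseteq> (\<Union>n. A n)"
  shows "\<exists>g :: 'a csuc \<Rightarrow> nat \<Rightarrow> 'a. (\<forall>x\<in>below L. range (g x) \<subseteq> L) \<and> inj_on g (below L) \<and>
    L \<subseteq> (\<lambda>x. g x 0) ` below L \<and>
    (\<forall>S. countable S \<longrightarrow> card_of {x \<in> below L. range (g x) \<subseteq> S} \<le>o card_of L)"
proof -
  have "\<forall>d. \<exists>p. d \<in> below L \<longrightarrow> inj_on p {..<d} \<and> p ` {..<d} \<subseteq> L"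
    by (simp add: below_def card_of_ordLeq)
  from choice[OF this] obtain p
    where p: "\<And>d. d \<in> below L \<Longrightarrow> inj_on (p d) {..<d}" "\<And>d. d \<in> below L \<Longrightarrow> p d ` {..<d} \<subseteq> L"
    by blast
  \<comment> \<open>The injection \<open>p d\<close> sorts the predecessors of \<open>d\<close> by
    the sets \<open>A n\<close>. The closure may contain \<open>d\<close> itself, so it is cut back
    to \<open>{..<d}\<close>, as the recursion on \<open>d\<close> requires.\<close>
  define B where "B d n = order_closure {x. x < d \<and> p d x \<in> A n} \<inter> {..<d}" for d n
  have B_less: "x < d" if "x \<in> B d n" for x d n
    using that unfolding B_def by simp
  have B_mono: "B d m \<subseteq> B d n" if "m \<le> n" for d m n
    unfolding B_def using monoD[OF A(3) that] by (intro Int_mono order_closure_mono) auto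
  have B_cover: "\<exists>n. x \<in> B d n" if d: "d \<in> below L" and x: "x < d" for d x
  proof -
    obtain n where "p d x \<in> A n"
      using p(2)[OF d] A(4) x by blast
    then have "x \<in> {x. x < d \<and> p d x \<in> A n}"
      using x by simp
    then have "x \<in> order_closure {x. x < d \<and> p d x \<in> A n}"
      by (rule subsetD[OF subset_order_closure])
    then have "x \<in> B d n"
      using x by (simp add: B_def)
    then show ?thesis ..
  qed
  have B_closed: "x \<in> B d n" if "x < d" and lim: "\<And>y. y < x \<Longrightarrow> \<exists>b\<in>B d n. y < b \<and> b \<le> x" for d n x
  proof -
    have "x \<in> order_closure {x. x < d \<and> p d x \<in> A n}"
      using lim unfolding B_def by (intro order_closure_closed) blast
    then show ?thesis
      unfolding B_def using that(1) by simp
  qed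
  have B_card: "card_of (B d n) \<le>o card_of (A n)" if "d \<in> below L" for d n
  proof -
    have "inj_on (p d) {x. x < d \<and> p d x \<in> A n}"
      by (rule inj_on_subset[OF p(1)[OF that]]) auto
    then have "card_of {x. x < d \<and> p d x \<in> A n} \<le>o card_of (A n)"
      by (rule card_of_ordLeqI) auto
    then have "card_of (order_closure {x. x < d \<and> p d x \<in> A n}) \<le>o card_of (A n)"
      by (rule card_of_order_closure[OF A(1)])
    then show ?thesis
      unfolding B_def by (rule ordLeq_transitive[OF card_of_mono1[OF Int_lower1]])
  qed
  \<comment> \<open>Coordinate \<open>n\<close> takes values in \<open>below (A n)\<close>, whose
    regularity bounds the at most \<open>|A n|\<close> earlier values to be exceeded.\<close>
  define P where "P f d r \<longleftrightarrow>
    (d \<in> below L \<longrightarrow> (\<forall>n. r n \<in> below (A n) \<and> (\<forall>x\<in>B d n. f x n < r n)))"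
    for f :: "'a csuc \<Rightarrow> nat \<Rightarrow> 'a csuc" and d r
  have "\<exists>f. \<forall>d. P f d (f d)"
  proof (rule dependent_wf_choice[OF wf])
    fix f g :: "'a csuc \<Rightarrow> nat \<Rightarrow> 'a csuc" and d r
    assume "\<And>x. (x, d) \<in> {(x, y). x < y} \<Longrightarrow> f x = g x"
    then have "f x = g x" if "x \<in> B d n" for x n
      using B_less[OF that] by simp
    then show "P f d r = P g d r"
      unfolding P_def by simp
  next
    fix d and f :: "'a csuc \<Rightarrow> nat \<Rightarrow> 'a csuc"
    assume prev: "\<And>x. (x, d) \<in> {(x, y). x < y} \<Longrightarrow> P f x (f x)"
    show "\<exists>r. P f d r"
    proof (cases "d \<in> below L")
      case True
      have "\<exists>b. b \<in> below (A n) \<and> (\<forall>x\<in>B d n. f x n < b)" for n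
      proof -
        have "(\<lambda>x. f x n) ` B d n \<subseteq> below (A n)"
          using prev B_less below_downward[OF True] unfolding P_def by (auto intro: less_imp_le)
        moreover have "card_of ((\<lambda>x. f x n) ` B d n) \<le>o card_of (A n)"
          using B_card[OF True] by (rule ordLeq_transitive[OF card_of_image])
        ultimately have "\<exists>b\<in>below (A n). \<forall>z\<in>(\<lambda>x. f x n) ` B d n. z < b"
          by (rule below_bounded[OF A(1)])
        then show ?thesis
          by auto
      qed
      then show ?thesis
        unfolding P_def by metis
    qed (simp add: P_def)
  qed
  then obtain f where "\<And>d. P f d (f d)"
    by blast
  then have f_below: "f d n \<in> below (A n)" and f_less: "\<And>x. x \<in> B d n \<Longrightarrow> f x n < f d n"
    if "d \<in> below L" for d n
    using that unfolding P_def by blast+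
  \<comment> \<open>As \<open>|A n| < |L|\<close>, its successor is at most \<open>|L|\<close>, so
    the values at coordinate \<open>n\<close> can be coded in \<open>L\<close>.\<close>
  have "\<exists>q. inj_on q (below (A n)) \<and> q ` below (A n) \<subseteq> L" for n
  proof -
    have "cardSuc (card_of (A n)) \<le>o card_of L"
      by (intro cardSuc_least card_of_Card_order A(2))
    then have "card_of (below (A n)) \<le>o card_of L"
      by (rule ordIso_ordLeq_trans[OF card_of_below[OF A(1)]])
    then show ?thesis
      by (simp add: card_of_ordLeq)
  qed
  then have "\<forall>n. \<exists>q. inj_on q (below (A n)) \<and> q ` below (A n) \<subseteq> L" ..
  from choice[OF this] obtain q
    where q: "\<And>n. inj_on (q n) (below (A n))" "\<And>n. q n ` below (A n) \<subseteq> L"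
    by blast
  have "card_of L \<le>o card_of (below L)"
    using cardSuc_ordLeq[OF card_of_Card_order] ordIso_symmetric[OF card_of_below[OF inf]]
    by (rule ordLeq_ordIso_trans)
  moreover have "L \<noteq> {}"
    using inf by auto
  ultimately have "\<exists>h. h ` below L = L"
    by (simp add: card_of_ordLeq2)
  then obtain h where h: "h ` below L = L" ..
  define g where "g x n = (case n of 0 \<Rightarrow> h x | Suc m \<Rightarrow> q m (f x m))" for x and n :: nat
  have g_Suc: "g x (Suc n) = q n (f x n)" for x n
    by (simp add: g_def)
  have "g x n \<in> L" if "x \<in> below L" for x n
  proof (cases n)
    case 0
    then show ?thesis using that h by (auto simp: g_def)
  next
    case (Suc m)
    then show ?thesis using q(2)[of m] f_below[OF that, of m] by (auto simp: g_def)
  qed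
  then have "\<forall>x\<in>below L. range (g x) \<subseteq> L"
    by blast
  moreover have differ: "g x \<noteq> g y" if xy: "y \<in> below L" "x < y" for x y
  proof
    assume eq: "g x = g y"
    obtain n where n: "x \<in> B y n"
      using B_cover[OF xy] by blast
    have "x \<in> below L"
      using below_downward[OF xy(1)] xy(2) by simp
    then have "f x n = f y n"
      using eq g_Suc q(1) f_below xy(1) by (metis inj_onD)
    then show False
      using f_less[OF xy(1) n] by simp
  qed
  have "inj_on g (below L)"
  proof (rule inj_onI)
    fix x y assume "x \<in> below L" "y \<in> below L" "g x = g y"
    then show "x = y"
      using differ[of y x] differ[of x y] by (cases x y rule: linorder_cases) auto
  qed
  moreover have "L \<subseteq> (\<lambda>x. g x 0) ` below L"
    using h by (auto simp: g_def)
  moreover have "card_of {x \<in> below L. range (g x) \<subseteq> S} \<le>o card_of L" if S: "countable S" for S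
  proof (rule ccontr)
    define Y where "Y = {x \<in> below L. range (g x) \<subseteq> S}"
    assume "\<not> card_of {x \<in> below L. range (g x) \<subseteq> S} \<le>o card_of L"
    then have big: "\<not> card_of Y \<le>o card_of L"
      unfolding Y_def .
    have sub: "Y \<subseteq> below L"
      unfolding Y_def by blast
    \<comment> \<open>A bound would confine \<open>Y\<close> to a segment of size at most
      \<open>|L|\<close>.\<close>
    have unb: "\<exists>y\<in>Y. x < y" if "x \<in> below L" for x
    proof (rule ccontr)
      assume "\<not> (\<exists>y\<in>Y. x < y)"
      then have "Y \<subseteq> {..x}"
        by (auto simp: not_less)
      then have "card_of Y \<le>o card_of L"
        using card_of_atMost_below[OF inf that] by (rule ordLeq_transitive[OF card_of_mono1])
      then show False
        using big by simp
    qed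
    obtain n where n: "uncountable ((\<lambda>y. f y n) ` Y)"
      using uncountable_value_set[where f=f and B=B, OF inf om3 B_mono B_cover B_closed f_less sub unb]
      by blast
    \<comment> \<open>Coding is injective, so uncountably many values survive in the countable set
      \<open>S\<close>.\<close>
    have "inj_on (q n) ((\<lambda>y. f y n) ` Y)"
      using q(1) by (rule inj_on_subset) (use f_below sub in auto)
    moreover have "q n ` (\<lambda>y. f y n) ` Y \<subseteq> S"
    proof safe
      fix y assume "y \<in> Y"
      then have "g y (Suc n) \<in> S"
        unfolding Y_def by blast
      then show "q n (f y n) \<in> S"
        by (simp add: g_Suc)
    qed
    then have "countable (q n ` (\<lambda>y. f y n) ` Y)"
      using S by (rule countable_subset)
    ultimately show False
      using n countable_image_inj_on by blast
  qed
  ultimately show ?thesis by blast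
qed

section \<open>The graph\<close>

text \<open>Equality of the two cardinals would transfer regularity to \<open>|L|\<close>.\<close>

lemma regularCard_less_singular:
  assumes "Cinfinite r" "regularCard r" "r \<le>o card_of L" "\<not> regularCard (card_of L)"
  shows "r <o card_of L"
  using assms(3) regularCard_ordIso[OF _ assms(1,2)] assms(4)
  unfolding ordLeq_iff_ordLess_or_ordIso by auto

lemma regularCard_csuc:
  assumes "infinite (UNIV :: 'a set)"
  shows "regularCard (card_of (UNIV :: 'a csuc set))"
proof -
  have c: "Cinfinite (card_of (UNIV :: 'a set))"
    using assms by (simp add: cinfinite_def Field_card_of card_of_card_order_on)
  show ?thesis
    by (rule regularCard_ordIso[OF ordIso_symmetric[OF card_of_UNIV_csuc] Cinfinite_cardSuc[OF c] regularCard_cardSuc[OF c]])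
qed

lemma csuc_ordLeq_singular:
  assumes "infinite (UNIV :: 'a set)" "regularCard (card_of (UNIV :: 'a set))"
    "card_of (UNIV :: 'a set) \<le>o card_of L" "\<not> regularCard (card_of L)"
  shows "card_of (UNIV :: 'a csuc set) \<le>o card_of L"
proof -
  have "Cinfinite (card_of (UNIV :: 'a set))"
    using assms by (simp add: cinfinite_def Field_card_of card_of_card_order_on)
  then have "card_of (UNIV :: 'a set) <o card_of L"
    using assms regularCard_less_singular by blast
  then have "cardSuc (card_of (UNIV :: 'a set)) \<le>o card_of L"
    by (intro cardSuc_least card_of_Card_order)
  then show ?thesis
    by (rule ordIso_ordLeq_trans[OF card_of_UNIV_csuc])
qed

text \<open>The cardinals \<open>\<omega>\<close>, \<open>\<omega>\<^sub>1\<close> and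
  \<open>\<omega>\<^sub>2\<close> are regular, so each lies strictly below the singular
  \<open>|L|\<close> and its successor is still at most \<open>|L|\<close>.\<close>

lemma singular_bounds:
  assumes inf: "infinite L" and sing: "\<not> regularCard (card_of L)"
  shows "natLeq <o card_of L" "card_of (UNIV :: nat csuc csuc csuc set) \<le>o card_of L"
proof -
  have "natLeq \<le>o card_of L"
    using inf infinite_iff_natLeq_ordLeq by blast
  then show "natLeq <o card_of L"
    using sing natLeq_Cinfinite regularCard_natLeq regularCard_less_singular by blast
  have nat: "regularCard (card_of (UNIV :: nat set))" "card_of (UNIV :: nat set) \<le>o card_of L"
    using regularCard_ordIso[OF ordIso_symmetric[OF card_of_nat] natLeq_Cinfinite regularCard_natLeq]
      inf infinite_iff_card_of_nat by blast+
  note inf' = infinite_UNIV_nat infinite_UNIV_csuc[OF infinite_UNIV_nat]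
    infinite_UNIV_csuc[OF infinite_UNIV_csuc[OF infinite_UNIV_nat]]
  show "card_of (UNIV :: nat csuc csuc csuc set) \<le>o card_of L"
    by (intro csuc_ordLeq_singular regularCard_csuc inf' nat sing)
qed

lemma card_of_lists_infinite:
  assumes "infinite L"
  shows "card_of (lists L) \<le>o card_of L"
proof -
  have level: "card_of {xs \<in> lists L. length xs = n} \<le>o card_of L" for n
  proof (induction n)
    case 0
    have "{xs \<in> lists L. length xs = 0} = {[]}"
      by auto
    then show ?case
      using assms by (metis card_of_singl_ordLeq finite.emptyI)
  next
    case (Suc n)
    let ?T = "L \<times> {xs \<in> lists L. length xs = n}"
    have "card_of ?T \<le>o card_of L"
      using Suc assms by (intro card_of_Times_ordLeq_infinite_Field card_of_Card_order)
        (simp_all add: Field_card_of card_of_mono1)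
    moreover have "{xs \<in> lists L. length xs = Suc n} \<subseteq> (\<lambda>(x, xs). x # xs) ` ?T"
      by (auto simp: length_Suc_conv image_iff)
    ultimately show ?case
      using ordLeq_transitive[OF card_of_mono1 ordLeq_transitive[OF card_of_image]] by blast
  qed
  have "card_of (\<Union>n. {xs \<in> lists L. length xs = n}) \<le>o card_of L"
    using assms level by (intro card_of_UNION_ordLeq_infinite card_of_countable) auto
  moreover have "lists L \<subseteq> (\<Union>n. {xs \<in> lists L. length xs = n})"
    by auto
  ultimately show ?thesis
    using ordLeq_transitive[OF card_of_mono1] by blast
qed

text \<open>Only finitely many prefixes have length at most \<open>n\<close>, so some prefix in
  \<open>C\<close> is long enough to show the value \<open>h n\<close>.\<close>

lemma infinite_prefixes_range:
  assumes "infinite {a \<in> C. a = map h [0..<length a]}"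
  shows "range h \<subseteq> (\<Union>a\<in>C. set a)"
proof safe
  fix n
  have "\<exists>a\<in>C. a = map h [0..<length a] \<and> n < length a"
  proof (rule ccontr)
    assume "\<not> ?thesis"
    then have "{a \<in> C. a = map h [0..<length a]} \<subseteq> (\<lambda>k. map h [0..<k]) ` {..n}"
      by (auto simp: not_less)
    then show False
      using assms finite_subset by blast
  qed
  then obtain a where a: "a \<in> C" "a = map h [0..<length a]" "n < length a"
    by blast
  have "h n = a ! n"
    by (subst a(2)) (simp add: a(3))
  then show "h n \<in> (\<Union>a\<in>C. set a)"
    using a(1,3) nth_mem by auto
qed

text \<open>With every comparable pair an edge, each \<open>s\<close> below \<open>t\<close> is
  itself a neighbour of \<open>t\<close>, which gives cofinality.\<close>

lemma type_T_graph_all_comparable: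
  assumes "\<forall>f\<in>X. range f \<subseteq> L" "card_of X =o kap"
  shows "type_T_graph L kap {map f [0..<n] | f n. f \<in> X} X {(xs, f). f \<in> X \<and> xs = map f [0..<length xs]}"
proof -
  define T where "T = down_closure X"
  define E where "E = {(s, t). s \<in> T \<and> t \<in> T \<and> s \<noteq> t \<and> comparable s t}"
  have "tree_with_tops L kap X T"
    using assms by (simp add: tree_with_tops_def T_def)
  moreover have "T_graph T E"
  proof -
    have "tless s t \<Longrightarrow> s \<noteq> t" for s t :: "'a tnode"
      by (auto simp: tless_def split: sum.splits)
    then show ?thesis
      unfolding T_graph_def E_def by (auto simp: sym_def comparable_def)
  qed
  moreover have "{map f [0..<n] | f n. f \<in> X} = {xs. Inl xs \<in> T}"
    unfolding T_def down_closure_def by auto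
  moreover have "{(xs, f). f \<in> X \<and> xs = map f [0..<length xs]} = {(xs, f). (Inl xs, Inr f) \<in> E}"
    unfolding E_def T_def down_closure_def by (auto simp: comparable_def tless_def)
  ultimately show ?thesis
    unfolding type_T_graph_def by blast
qed

theorem theorem7p1:
  fixes L :: "'a set"
  assumes "infinite L"
    and "\<not> regularCard (card_of L)"
    and "\<exists>K. K \<subseteq> L \<and> cofinal K (card_of L) \<and> countable K"
  shows "\<exists>A B H. type_T_graph L (cardSuc (card_of L)) A B H \<and>
                 lk_graph (card_of L) (cardSuc (card_of L)) A B H \<and>
                 \<not> has_subgraph natLeq (cardSuc (card_of L)) A B H"
proof -
  let ?k = "cardSuc (card_of L)"
  note bounds = singular_bounds[OF assms(1,2)]
  obtain K where K: "K \<subseteq> L" "cofinal K (card_of L)" "countable K"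
    using assms(3) by blast
  obtain A :: "nat \<Rightarrow> 'a set" where A: "\<forall>n. infinite (A n) \<and> card_of (A n) <o card_of L"
      "mono A" "L \<subseteq> (\<Union>n. A n)"
    using countable_exhaustion[OF assms(1) bounds(1) K] by (elim exE conjE)
  obtain g :: "'a csuc \<Rightarrow> nat \<Rightarrow> 'a" where g: "\<forall>x\<in>below L. range (g x) \<subseteq> L" "inj_on g (below L)"
      "L \<subseteq> (\<lambda>x. g x 0) ` below L"
      "\<forall>S. countable S \<longrightarrow> card_of {x \<in> below L. range (g x) \<subseteq> S} \<le>o card_of L"
    using ex_sparse_functions[OF assms(1) bounds(2) conjunct1 conjunct2 A(2,3), OF spec[OF A(1)] spec[OF A(1)]]
    by (elim exE conjE)
  define X where "X = g ` below L"
  define V where "V = {map f [0..<n] | f n. f \<in> X}"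
  define H where "H = {(xs, f). f \<in> X \<and> xs = map f [0..<length xs]}"
  have XL: "\<forall>f\<in>X. range f \<subseteq> L"
    using g(1) by (simp add: X_def)
  have "card_of (below L) =o card_of X"
    using g(2) unfolding X_def by (rule card_of_ordIsoI[OF inj_on_imp_bij_betw])
  then have Xk: "card_of X =o ?k"
    using card_of_below[OF assms(1)] ordIso_symmetric ordIso_transitive by blast
  have "type_T_graph L ?k V X H"
    unfolding V_def H_def by (rule type_T_graph_all_comparable[OF XL Xk])
  moreover have "lk_graph (card_of L) ?k V X H"
  proof -
    have "V \<subseteq> lists L"
      using XL unfolding V_def by (fastforce simp: image_subset_iff)
    then have "card_of V \<le>o card_of L"
      using card_of_lists_infinite[OF assms(1)] by (rule ordLeq_transitive[OF card_of_mono1])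
    \<comment> \<open>Sequences of length one already give \<open>|L|\<close> vertices, because the
      zeroth coordinates exhaust \<open>L\<close>.\<close>
    moreover have "(\<lambda>l. [l]) ` L \<subseteq> V"
    proof safe
      fix l assume "l \<in> L"
      then obtain x where "x \<in> below L" "l = g x 0"
        using g(3) by blast
      then have "[l] = map (g x) [0..<1]" "g x \<in> X"
        by (auto simp: X_def)
      then show "[l] \<in> V"
        unfolding V_def by (intro CollectI exI conjI)
    qed
    then have "card_of L \<le>o card_of V"
      using card_of_ordLeqI[of "\<lambda>l. [l]" L V] by (auto simp: inj_on_def)
    ultimately have "card_of V =o card_of L"
      by (simp add: ordIso_iff_ordLeq)
    moreover have "infinite {a \<in> V. (a, f) \<in> H}" if "f \<in> X" for f
    proof -
      have "inj (\<lambda>n. map f [0..<n])"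
        by (rule injI) (metis diff_zero length_map length_upt)
      then have "infinite (range (\<lambda>n. map f [0..<n]))"
        using range_inj_infinite by blast
      moreover have "range (\<lambda>n. map f [0..<n]) \<subseteq> {a \<in> V. (a, f) \<in> H}"
        using that unfolding V_def H_def by auto
      ultimately show ?thesis
        using finite_subset by blast
    qed
    moreover have "H \<subseteq> V \<times> X"
      unfolding V_def H_def by blast
    ultimately show ?thesis
      using Xk unfolding lk_graph_def by blast
  qed
  moreover have "\<not> has_subgraph natLeq ?k V X H"
  proof
    assume "has_subgraph natLeq ?k V X H"
    then obtain C D F where sub: "D \<subseteq> X" "F \<subseteq> H" and C: "card_of C =o natLeq" and D: "card_of D =o ?k"
      and nb: "\<And>f. f \<in> D \<Longrightarrow> infinite {a \<in> C. (a, f) \<in> F}"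
      unfolding has_subgraph_def lk_graph_def by auto
    \<comment> \<open>Every top in \<open>D\<close> has infinitely many of its prefixes in the
      countable set \<open>C\<close>, so its range lies in the countable set \<open>S\<close>;
      sparseness then limits \<open>D\<close> to size \<open>|L|\<close>.\<close>
    define S where "S = (\<Union>a\<in>C. set a)"
    have "card_of C \<le>o card_of (UNIV :: nat set)"
      using C card_of_nat ordIso_iff_ordLeq ordIso_symmetric ordIso_transitive by blast
    then obtain e :: "'a list \<Rightarrow> nat" where "inj_on e C"
      using card_of_ordLeq[of C "UNIV :: nat set"] by blast
    then have "countable C"
      by (rule countableI)
    then have S: "countable S"
      unfolding S_def by (intro countable_UN) (auto intro: countable_finite)
    have "D \<subseteq> g ` {x \<in> below L. range (g x) \<subseteq> S}"
    proof
      fix f assume f: "f \<in> D"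
      have "{a \<in> C. (a, f) \<in> F} \<subseteq> {a \<in> C. a = map f [0..<length a]}"
        using sub(2) unfolding H_def by auto
      then have "infinite {a \<in> C. a = map f [0..<length a]}"
        using nb[OF f] finite_subset by blast
      then have "range f \<subseteq> S"
        unfolding S_def by (rule infinite_prefixes_range)
      then show "f \<in> g ` {x \<in> below L. range (g x) \<subseteq> S}"
        using f sub(1) unfolding X_def by auto
    qed
    then have "card_of D \<le>o card_of {x \<in> below L. range (g x) \<subseteq> S}"
      by (rule ordLeq_transitive[OF card_of_mono1 card_of_image])
    then have "card_of D \<le>o card_of L"
      using g(4)[rule_format, OF S] by (rule ordLeq_transitive)
    then have "?k \<le>o card_of L"
      by (rule ordIso_ordLeq_trans[OF ordIso_symmetric[OF D]])
    then show False
      using cardSuc_greater[OF card_of_Card_order] not_ordLess_ordLeq by blast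
  qed
  ultimately show ?thesis
    by blast
qed

end
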